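(* Let $p_n=(F,X,\Gamma,\varphi)$ be a balanced $\varphi$-commutative preseed in $\mathcal{D}_n$ with $X=\{x_1,\dots,x_n\}$ and frozen rank $(a_1,\dots,a_n)$. For $l\in\mathbb{Z}$ let $\phi_l$ be the $R_n$-linear automorphism of $\mathcal{D}_n$ induced by $$\phi_l(t)=t\ \ \text{for all } t\in R_n,\qquad \phi_l(x_k)=\varphi^{l a_k}(x_k)\ \ \text{for all } k\in[1,n].$$ Then, for every $l\in\mathbb{Z}$, $\phi_l$ is a cluster variable preserver of $p_n$, i.e. $\phi_l$ leaves the cluster set $\mathcal{X}(p_n)$ invariant.
   Context: Throughout, $K$ is a field of characteristic zero and $[1,k]=\{1,\dots,k\}$. Ambient rings. For $i\in[1,n]$ let $F_i=\{f_{i1},\dots,f_{im_i}\}$ be a finite set of "frozen variables"; $\mathbb{P}_i$ is the free abelian group (written multiplicatively) with generating set $F_1\cup\dots\cup F_i$, and $R_i=K[\mathbb{P}_i]$ is its group ring. $D_1\subset D_2\subset\dots\subset D_n$ are Ore domains with $R_i\subset D_i$, together with elements $t_i\in D_i$ (with $t_i^{-1}\in D_i$) such that $t_it_j=t_jt_i$ and $t_if_{jr}=f_{jr}t_i$ for all $i\ne j$ and $r\in[1,m_j]$, and the monomials $t_1^{\alpha_1}\cdots t_i^{\alpha_i}$, $\alpha_1,\dots,\alpha_i\in\mathbb{Z}$, form a basis of $D_i$ as a left $R_i$-module. $\mathcal{D}_i$ is the division ring of right fractions $ab^{-1}$, $a,b\in D_i$, $b\neq0$; so $\mathcal{D}_1\subset\dots\subset\mathcal{D}_n$.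 Star quivers. A valued quiver has vertices, arrows (no loops, no 2-cycles), and each arrow $i\to j$ carries a valuation $(v_{ij},v_{ji})$ of positive integers, for which there are positive integers $d_i$ with $d_iv_{ij}=v_{ji}d_j$. It is a star quiver with center $k$ if every arrow starts or ends at $k$. A star quiver with center $k$ is balanced with frozen component $a_k\in\mathbb{Z}_{\ge0}$ if $\sum_{k\to j}v_{kj}=\sum_{k\to j}v_{jk}=\sum_{i\to k}v_{ik}=\sum_{i\to k}v_{ki}=a_k$. Preseeds. A preseed of rank $n$ in $\mathcal{D}_n$ is a triple $(F,X,\Gamma)$ with $F=\{F_1,\dots,F_n\}$, $X=\{x_1,\dots,x_n\}$, $\Gamma=\{\Gamma_1,\dots,\Gamma_n\}$ such that for each $k$: $x_k\in\mathcal{D}_k$ is the image of $t_k$ under some $R_k$-linear automorphism of $\mathcal{D}_k$ fixing the frozen variables, and $\Gamma_k$ is a star quiver with $m_k+1$ vertices, whose center corresponds to $x_k$ and whose other vertices correspond to $f_{k1},\dots,f_{km_k}$. The preseed is balanced with frozen rank $(a_1,\dots,a_n)$ if each $\Gamma_k$ is balanced with frozen component $a_k$. It is $\varphi$-commutative, written $(F,X,\Gamma,\varphi)$, if $\varphi$ is an $R_n$-linear (ring) automorphism of $\mathcal{D}_n$ with $fx_i=\varphi(x_i)f$ for all $f\in F_i$ and all $i\in[1,n]$. Mutations. Put $\xi_k=\prod_{j\to k}f_{kj}^{v_{jk}}+\prod_{k\to j}f_{kj}^{v_{kj}}$ (products over the arrows of $\Gamma_k$ into, respectively out of, its center $k$).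 The right mutation $\mu_k^R$ (left mutation $\mu^L_k$) replaces $x_k$ by $\xi_kx_k^{-1}$ (by $x_k^{-1}\xi_k$), keeps $x_i$ for $i\neq k$, keeps $F$, and replaces $\Gamma_k$ by the quiver with all arrows reversed (components of the valuations switched), keeping the other $\Gamma_i$. A cluster variable of $p_n$ is an element of some cluster obtained from $p_n$ by a finite (possibly empty) sequence of right or left mutations; the cluster set $\mathcal{X}(p_n)$ is the set of all of them. *)

theory Defs
  imports "HOL-Library.Poly_Mapping" "HOL-Library.FuncSet"
begin

text \<open>
  The pair \<open>(j, r)\<close> stands for the frozen variable \<open>f_{jr}\<close>. The free abelian group on these
  symbols is written additively (exponent vectors); finitely supported functions on it with
  the convolution product are its group ring over \<open>'k\<close>.
\<close>

type_synonym frozen_monomial = "(nat \<times> nat) \<Rightarrow>\<^sub>0 int"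
type_synonym 'k group_ring = "frozen_monomial \<Rightarrow>\<^sub>0 'k"

definition frozen_var :: "nat \<Rightarrow> nat \<Rightarrow> 'k::field_char_0 group_ring" where
  "frozen_var j r = Poly_Mapping.single (Poly_Mapping.single (j, r) 1) 1"

definition frozen_group :: "(nat \<Rightarrow> nat) \<Rightarrow> nat \<Rightarrow> frozen_monomial set" where
  "frozen_group m i = {p. Poly_Mapping.keys p \<subseteq> (SIGMA j:{1..i}. {1..m j})}"

definition ground_ring :: "(nat \<Rightarrow> nat) \<Rightarrow> nat \<Rightarrow> 'k::field_char_0 group_ring set" where
  "ground_ring m i = {a. Poly_Mapping.keys a \<subseteq> frozen_group m i}"

definition is_subring :: "'d::division_ring set \<Rightarrow> bool" where
  "is_subring S \<longleftrightarrow>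
     0 \<in> S \<and> 1 \<in> S \<and> (\<forall>x\<in>S. \<forall>y\<in>S. x - y \<in> S \<and> x * y \<in> S)"

text \<open>Subrings of a division ring are domains, so only the (right) Ore condition is left.\<close>

definition is_ore_domain :: "'d::division_ring set \<Rightarrow> bool" where
  "is_ore_domain S \<longleftrightarrow>
     is_subring S \<and>
     (\<forall>a\<in>S. \<forall>b\<in>S. a \<noteq> 0 \<longrightarrow> b \<noteq> 0 \<longrightarrow> (\<exists>c\<in>S. \<exists>d\<in>S. a * c = b * d \<and> a * c \<noteq> 0))"

definition right_fractions :: "'d::division_ring set \<Rightarrow> 'd set" where
  "right_fractions S = {a * inverse b | a b. a \<in> S \<and> b \<in> S \<and> b \<noteq> 0}"

definition is_left_basis ::
  "'d::division_ring set \<Rightarrow> 'd set \<Rightarrow> 'i set \<Rightarrow> ('i \<Rightarrow> 'd) \<Rightarrow> bool" where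
  "is_left_basis R M I b \<longleftrightarrow>
     b ` I \<subseteq> M \<and>
     (\<forall>x\<in>M. \<exists>S c. finite S \<and> S \<subseteq> I \<and> c ` S \<subseteq> R \<and> x = (\<Sum>s\<in>S. c s * b s)) \<and>
     (\<forall>S c. finite S \<and> S \<subseteq> I \<and> c ` S \<subseteq> R \<and> (\<Sum>s\<in>S. c s * b s) = 0 \<longrightarrow> (\<forall>s\<in>S. c s = 0))"

definition t_monomial :: "(nat \<Rightarrow> 'd::division_ring) \<Rightarrow> nat \<Rightarrow> (nat \<Rightarrow> int) \<Rightarrow> 'd" where
  "t_monomial t i \<alpha> = prod_list (map (\<lambda>j. t j powi \<alpha> j) [1..<Suc i])"

text \<open>
  The type \<open>'d\<close> is the largest division ring \<open>\<D>_n\<close> (assumption \<open>fractions_top\<close>); the \<open>D_i\<close> and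
  \<open>\<D>_i = right_fractions (D i)\<close> are subsets of it. The map \<open>emb\<close> is the inclusion of \<open>R_n\<close>;
  its values outside \<open>R_n\<close> are irrelevant. The scalars are not assumed to be central.
\<close>

locale ore_tower =
  fixes n :: nat
    and m :: "nat \<Rightarrow> nat"
    and emb :: "'k::field_char_0 group_ring \<Rightarrow> 'd::division_ring"
    and D :: "nat \<Rightarrow> 'd set"
    and t :: "nat \<Rightarrow> 'd"
  assumes n_pos: "1 \<le> n"
    and emb_one: "emb 1 = 1"
    and emb_add: "\<And>a b. \<lbrakk>a \<in> ground_ring m n; b \<in> ground_ring m n\<rbrakk> \<Longrightarrow> emb (a + b) = emb a + emb b"
    and emb_mult: "\<And>a b. \<lbrakk>a \<in> ground_ring m n; b \<in> ground_ring m n\<rbrakk> \<Longrightarrow> emb (a * b) = emb a * emb b"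
    and emb_inj: "inj_on emb (ground_ring m n)"
    and D_ore: "\<And>i. i \<in> {1..n} \<Longrightarrow> is_ore_domain (D i)"
    and D_mono: "\<And>i j. \<lbrakk>i \<in> {1..n}; j \<in> {1..n}; i \<le> j\<rbrakk> \<Longrightarrow> D i \<subseteq> D j"
    and ground_subset: "\<And>i. i \<in> {1..n} \<Longrightarrow> emb ` ground_ring m i \<subseteq> D i"
    and t_unit: "\<And>i. i \<in> {1..n} \<Longrightarrow> t i \<in> D i \<and> t i \<noteq> 0 \<and> inverse (t i) \<in> D i"
    and t_commute: "\<And>i j. \<lbrakk>i \<in> {1..n}; j \<in> {1..n}; i \<noteq> j\<rbrakk> \<Longrightarrow> t i * t j = t j * t i"
    and t_frozen_commute: "\<And>i j r. \<lbrakk>i \<in> {1..n}; j \<in> {1..n}; i \<noteq> j; r \<in> {1..m j}\<rbrakk>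
          \<Longrightarrow> t i * emb (frozen_var j r) = emb (frozen_var j r) * t i"
    and t_basis: "\<And>i. i \<in> {1..n} \<Longrightarrow>
          is_left_basis (emb ` ground_ring m i) (D i) ({1..i} \<rightarrow>\<^sub>E (UNIV :: int set)) (t_monomial t i)"
    and fractions_top: "right_fractions (D n) = UNIV"

definition linear_automorphism :: "'d::division_ring set \<Rightarrow> 'd set \<Rightarrow> ('d \<Rightarrow> 'd) \<Rightarrow> bool" where
  "linear_automorphism R S \<sigma> \<longleftrightarrow>
     bij_betw \<sigma> S S \<and> \<sigma> 1 = 1 \<and>
     (\<forall>x\<in>S. \<forall>y\<in>S. \<sigma> (x + y) = \<sigma> x + \<sigma> y \<and> \<sigma> (x * y) = \<sigma> x * \<sigma> y) \<and>
     (\<forall>r\<in>R. \<forall>x\<in>S. \<sigma> (r * x) = r * \<sigma> x)"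

definition aut_pow :: "('d \<Rightarrow> 'd) \<Rightarrow> int \<Rightarrow> 'd \<Rightarrow> 'd" where
  "aut_pow \<phi> z = (if 0 \<le> z then \<phi> ^^ nat z else (inv \<phi>) ^^ nat (- z))"

text \<open>An arrow \<open>i \<rightarrow> j\<close> is a pair \<open>(i, j)\<close>, and \<open>val Q i j\<close> is \<open>v_{ij}\<close>.\<close>

record 'v quiver =
  verts :: "'v set"
  arrows :: "('v \<times> 'v) set"
  val :: "'v \<Rightarrow> 'v \<Rightarrow> nat"

definition valued_quiver :: "'v quiver \<Rightarrow> bool" where
  "valued_quiver Q \<longleftrightarrow>
     finite (verts Q) \<and> arrows Q \<subseteq> verts Q \<times> verts Q \<and>
     (\<forall>i. (i, i) \<notin> arrows Q) \<and>
     (\<forall>i j. (i, j) \<in> arrows Q \<longrightarrow> (j, i) \<notin> arrows Q) \<and>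
     (\<forall>(i, j)\<in>arrows Q. 0 < val Q i j \<and> 0 < val Q j i) \<and>
     (\<exists>d :: 'v \<Rightarrow> nat. (\<forall>i\<in>verts Q. 0 < d i) \<and>
        (\<forall>(i, j)\<in>arrows Q. d i * val Q i j = val Q j i * d j))"

definition star_quiver :: "'v quiver \<Rightarrow> 'v \<Rightarrow> bool" where
  "star_quiver Q c \<longleftrightarrow>
     valued_quiver Q \<and> c \<in> verts Q \<and> (\<forall>(i, j)\<in>arrows Q. i = c \<or> j = c)"

definition balanced_star :: "'v quiver \<Rightarrow> 'v \<Rightarrow> nat \<Rightarrow> bool" where
  "balanced_star Q c a \<longleftrightarrow>
     (\<Sum>j | (c, j) \<in> arrows Q. val Q c j) = a \<and>
     (\<Sum>j | (c, j) \<in> arrows Q. val Q j c) = a \<and>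
     (\<Sum>i | (i, c) \<in> arrows Q. val Q i c) = a \<and>
     (\<Sum>i | (i, c) \<in> arrows Q. val Q c i) = a"

text \<open>
  Reversing all arrows and interchanging \<open>v_{ij}\<close> with \<open>v_{ji}\<close>: an arrow \<open>i \<rightarrow> j\<close> with
  valuation \<open>(v_{ij}, v_{ji})\<close> becomes \<open>j \<rightarrow> i\<close> with \<open>v'_{ji} = v_{ij}\<close> and \<open>v'_{ij} = v_{ji}\<close>.
  In particular the element \<open>\<xi>_k\<close> (\<open>exchange_elem\<close>) does not change under mutation at \<open>k\<close>.
\<close>

definition reverse_quiver :: "'v quiver \<Rightarrow> 'v quiver" where
  "reverse_quiver Q =
     \<lparr>verts = verts Q, arrows = (arrows Q)\<inverse>, val = (\<lambda>i j. val Q j i)\<rparr>"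

text \<open>
  The frozen sets \<open>F_k = {f_{k1}, \<dots>}\<close> never change and are part of the ambient data, so a
  preseed is recorded by \<open>X\<close> and \<open>\<Gamma>\<close>. In \<open>\<Gamma>_k\<close> the vertex \<open>0\<close> is the center (corresponding to
  \<open>x_k\<close>) and the vertex \<open>r \<in> {1..m k}\<close> corresponds to \<open>f_{kr}\<close>.
\<close>

record 'd preseed =
  cluster :: "nat \<Rightarrow> 'd"
  quivers :: "nat \<Rightarrow> nat quiver"

definition is_preseed ::
  "nat \<Rightarrow> (nat \<Rightarrow> nat) \<Rightarrow> ('k::field_char_0 group_ring \<Rightarrow> 'd::division_ring) \<Rightarrow> (nat \<Rightarrow> 'd set)
    \<Rightarrow> (nat \<Rightarrow> 'd) \<Rightarrow> 'd preseed \<Rightarrow> bool" where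
  "is_preseed n m emb D t p \<longleftrightarrow>
     (\<forall>k\<in>{1..n}.
        (\<exists>\<sigma>. linear_automorphism (emb ` ground_ring m k) (right_fractions (D k)) \<sigma> \<and>
             (\<forall>j\<in>{1..k}. \<forall>r\<in>{1..m j}. \<sigma> (emb (frozen_var j r)) = emb (frozen_var j r)) \<and>
             cluster p k = \<sigma> (t k)) \<and>
        star_quiver (quivers p k) 0 \<and> verts (quivers p k) = {0..m k})"

definition balanced_preseed :: "nat \<Rightarrow> 'd preseed \<Rightarrow> (nat \<Rightarrow> nat) \<Rightarrow> bool" where
  "balanced_preseed n p a \<longleftrightarrow> (\<forall>k\<in>{1..n}. balanced_star (quivers p k) 0 (a k))"

definition phi_commutative ::
  "nat \<Rightarrow> (nat \<Rightarrow> nat) \<Rightarrow> ('k::field_char_0 group_ring \<Rightarrow> 'd::division_ring) \<Rightarrow> (nat \<Rightarrow> 'd set)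
    \<Rightarrow> 'd preseed \<Rightarrow> ('d \<Rightarrow> 'd) \<Rightarrow> bool" where
  "phi_commutative n m emb D p \<phi> \<longleftrightarrow>
     linear_automorphism (emb ` ground_ring m n) (right_fractions (D n)) \<phi> \<and>
     (\<forall>i\<in>{1..n}. \<forall>r\<in>{1..m i}.
        emb (frozen_var i r) * cluster p i = \<phi> (cluster p i) * emb (frozen_var i r))"

definition exchange_elem :: "nat quiver \<Rightarrow> nat \<Rightarrow> 'k::field_char_0 group_ring" where
  "exchange_elem Q k =
     (\<Prod>j | (j, 0) \<in> arrows Q. frozen_var k j ^ val Q j 0) +
     (\<Prod>j | (0, j) \<in> arrows Q. frozen_var k j ^ val Q 0 j)"

definition right_mutation ::
  "('k::field_char_0 group_ring \<Rightarrow> 'd::division_ring) \<Rightarrow> nat \<Rightarrow> 'd preseed \<Rightarrow> 'd preseed" where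
  "right_mutation emb k p =
     \<lparr>cluster = (cluster p)(k := emb (exchange_elem (quivers p k) k) * inverse (cluster p k)),
      quivers = (quivers p)(k := reverse_quiver (quivers p k))\<rparr>"

definition left_mutation ::
  "('k::field_char_0 group_ring \<Rightarrow> 'd::division_ring) \<Rightarrow> nat \<Rightarrow> 'd preseed \<Rightarrow> 'd preseed" where
  "left_mutation emb k p =
     \<lparr>cluster = (cluster p)(k := inverse (cluster p k) * emb (exchange_elem (quivers p k) k)),
      quivers = (quivers p)(k := reverse_quiver (quivers p k))\<rparr>"

inductive mutation_reachable ::
  "nat \<Rightarrow> ('k::field_char_0 group_ring \<Rightarrow> 'd::division_ring) \<Rightarrow> 'd preseed \<Rightarrow> 'd preseed \<Rightarrow> bool"
  for n emb p where
  start: "mutation_reachable n emb p p"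
| right: "\<lbrakk>mutation_reachable n emb p q; k \<in> {1..n}\<rbrakk>
            \<Longrightarrow> mutation_reachable n emb p (right_mutation emb k q)"
| left: "\<lbrakk>mutation_reachable n emb p q; k \<in> {1..n}\<rbrakk>
            \<Longrightarrow> mutation_reachable n emb p (left_mutation emb k q)"

definition cluster_set ::
  "nat \<Rightarrow> ('k::field_char_0 group_ring \<Rightarrow> 'd::division_ring) \<Rightarrow> 'd preseed \<Rightarrow> 'd set" where
  "cluster_set n emb p = {cluster q i | q i. mutation_reachable n emb p q \<and> i \<in> {1..n}}"

definition cluster_variable_preserver ::
  "nat \<Rightarrow> (nat \<Rightarrow> nat) \<Rightarrow> ('k::field_char_0 group_ring \<Rightarrow> 'd::division_ring) \<Rightarrow> (nat \<Rightarrow> 'd set)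
    \<Rightarrow> 'd preseed \<Rightarrow> ('d \<Rightarrow> 'd) \<Rightarrow> bool" where
  "cluster_variable_preserver n m emb D p \<psi> \<longleftrightarrow>
     linear_automorphism (emb ` ground_ring m n) (right_fractions (D n)) \<psi> \<and>
     \<psi> ` cluster_set n emb p = cluster_set n emb p"

text \<open>
  \<open>induced_automorphism n m emb D p \<phi> a l \<psi>\<close> says that \<open>\<psi>\<close> is an \<open>R_n\<close>-linear automorphism of
  \<open>\<D>_n\<close> with the values prescribed for \<open>\<phi>_l\<close>. It is a predicate since the elements \<open>x_k\<close> of
  a preseed need not generate \<open>\<D>_n\<close> over \<open>R_n\<close>, so \<open>\<psi>\<close> need not be unique.
\<close>

definition induced_automorphism ::
  "nat \<Rightarrow> (nat \<Rightarrow> nat) \<Rightarrow> ('k::field_char_0 group_ring \<Rightarrow> 'd::division_ring) \<Rightarrow> (nat \<Rightarrow> 'd set)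
    \<Rightarrow> 'd preseed \<Rightarrow> ('d \<Rightarrow> 'd) \<Rightarrow> (nat \<Rightarrow> nat) \<Rightarrow> int \<Rightarrow> ('d \<Rightarrow> 'd) \<Rightarrow> bool" where
  "induced_automorphism n m emb D p \<phi> a l \<psi> \<longleftrightarrow>
     linear_automorphism (emb ` ground_ring m n) (right_fractions (D n)) \<psi> \<and>
     (\<forall>r\<in>ground_ring m n. \<psi> (emb r) = emb r) \<and>
     (\<forall>k\<in>{1..n}. \<psi> (cluster p k) = aut_pow \<phi> (l * int (a k)) (cluster p k))"

end

theory Submission
  imports Defs
begin

text \<open>
  The idea is that every automorphism in sight acts on the cluster as an inner automorphism, and
  that the same inner automorphisms are squares of mutations.

  Write \<open>\<xi>\<^sub>k\<close> for the exchange element of \<open>\<Gamma>\<^sub>k\<close>. Reversing \<open>\<Gamma>\<^sub>k\<close> only interchanges the two summands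
  of \<open>\<xi>\<^sub>k\<close>, so \<open>\<xi>\<^sub>k\<close> is the same in all mutated preseeds. The right mutation \<open>x \<mapsto> \<xi>\<^sub>k x\<inverse>\<close> and the left
  mutation \<open>x \<mapsto> x\<inverse> \<xi>\<^sub>k\<close> are then inverse to each other, and the square of the former is conjugation
  \<open>x \<mapsto> \<xi>\<^sub>k x \<xi>\<^sub>k\<inverse>\<close>. As mutations in different directions do not interact, the cluster set is the
  union over \<open>k\<close> of the elements \<open>\<xi>\<^sub>k\<^sup>i x\<^sub>k \<xi>\<^sub>k\<^sup>-\<^sup>i\<close> and \<open>\<xi>\<^sub>k\<^sup>i\<^sup>+\<^sup>1 x\<^sub>k\<inverse> \<xi>\<^sub>k\<^sup>-\<^sup>i\<close> with \<open>i\<close> an integer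
  (\<open>cluster_set_eq_orbits\<close>).

  Balancedness says that both monomials of \<open>\<xi>\<^sub>k\<close> have total degree \<open>a\<^sub>k\<close> in the frozen variables
  \<open>f\<^sub>k\<^sub>1, f\<^sub>k\<^sub>2, \<dots>\<close>. Each of these satisfies \<open>f x\<^sub>k = \<phi>(x\<^sub>k) f\<close>, and \<open>\<phi>\<close> fixes them, so both monomials,
  and hence \<open>\<xi>\<^sub>k\<close> itself, satisfy \<open>\<xi>\<^sub>k x\<^sub>k = \<phi>\<^bsup>a\<^sub>k\<^esup>(x\<^sub>k) \<xi>\<^sub>k\<close> (\<open>exchange_elem_intertwines\<close>). Since
  \<open>\<xi>\<^sub>k \<noteq> 0\<close> (this is where the characteristic enters, the two monomials being possibly equal),
  \<open>\<phi>\<^bsup>l a\<^sub>k\<^esup>(x\<^sub>k) = \<xi>\<^sub>k\<^sup>l x\<^sub>k \<xi>\<^sub>k\<^sup>-\<^sup>l\<close>. So an automorphism that fixes \<open>R\<^sub>n\<close> and takes the prescribed values on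
  the \<open>x\<^sub>k\<close> shifts the index \<open>i\<close> above by \<open>l\<close>, and permutes the cluster set.

  Such an automorphism exists: it is conjugation by the \<open>l\<close>-th power of \<open>\<Prod>\<^sub>k \<xi>\<^sub>k\<close>. Indeed \<open>R\<^sub>n\<close> is
  commutative, and \<open>\<xi>\<^sub>j\<close> commutes with \<open>x\<^sub>i\<close> for \<open>i \<noteq> j\<close> because the frozen variables in \<open>F\<^sub>j\<close> do
  (\<open>cluster_frozen_commute\<close>).
\<close>

section \<open>Conjugation in a division ring\<close>

definition inner_conj :: "'d::division_ring \<Rightarrow> 'd \<Rightarrow> 'd" where
  "inner_conj u x = u * x * inverse u"

lemma inverse_mult_distrib_division_ring:
  "inverse (x * y) = inverse y * inverse (x::'d::division_ring)"
  by (cases "x = 0 \<or> y = 0") (auto simp: nonzero_inverse_mult_distrib)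

lemma inner_conj_inner_conj: "inner_conj u (inner_conj v x) = inner_conj (u * v) x"
  by (simp add: inner_conj_def inverse_mult_distrib_division_ring mult.assoc)

lemma inner_conj_powi_add:
  assumes "u \<noteq> 0"
  shows "inner_conj (u powi i) (inner_conj (u powi j) x) = inner_conj (u powi (i + j)) x"
  using assms by (simp add: inner_conj_inner_conj power_int_add)

lemma inner_conj_one [simp]: "inner_conj 1 x = x"
  by (simp add: inner_conj_def)

lemma inner_conj_add: "inner_conj u (x + y) = inner_conj u x + inner_conj u y"
  by (simp add: inner_conj_def distrib_left distrib_right)

lemma inner_conj_mult:
  assumes "u \<noteq> 0"
  shows "inner_conj u (x * y) = inner_conj u x * inner_conj u y"
proof -
  have "inner_conj u x * inner_conj u y = u * x * (inverse u * u) * y * inverse u"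
    by (simp only: inner_conj_def mult.assoc)
  then show ?thesis
    by (simp only: left_inverse[OF assms] mult_1_right) (simp add: inner_conj_def mult.assoc)
qed

lemma inverse_inner_conj: "inverse (inner_conj u x) = inner_conj u (inverse x)"
  by (simp add: inner_conj_def inverse_mult_distrib_division_ring mult.assoc)

lemma inner_conj_eqI: "u * x = y * u \<Longrightarrow> u \<noteq> 0 \<Longrightarrow> inner_conj u x = y"
  by (simp add: inner_conj_def mult.assoc)

lemma powi_commute:
  fixes u x :: "'d::division_ring"
  assumes "u * x = x * u"
  shows "u powi i * x = x * u powi i"
proof -
  have pow: "v ^ k * x = x * v ^ k" if "v * x = x * v" for v :: 'd and k
    by (induction k) (simp_all add: mult.assoc that, metis mult.assoc that)
  show ?thesis
    using pow[OF assms] pow[OF mult_commute_imp_mult_inverse_commute[OF assms]]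
    by (simp add: power_int_def)
qed

lemma inner_conj_powi_commute:
  assumes "u * x = x * u" "u \<noteq> 0"
  shows "inner_conj (u powi i) x = x"
  using assms by (intro inner_conj_eqI powi_commute) auto

text \<open>
  This isolates one factor of the product that realizes the induced automorphism: at \<open>x\<^sub>k\<close> only
  the factor \<open>u = \<xi>\<^sub>k\<close> acts, as the product \<open>v\<close> of the others commutes with \<open>x\<^sub>k\<close>.
\<close>

lemma inner_conj_powi_mult_left:
  assumes "u * v = v * u" "u \<noteq> 0" "v \<noteq> 0" and "v * x = x * v"
  shows "inner_conj ((u * v) powi i) x = inner_conj (u powi i) x"
proof -
  have uv: "u * v \<noteq> 0" using assms by simp
  have step: "inner_conj (u * v) (inner_conj (u powi j) x) = inner_conj (u powi (j + 1)) x" for j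
  proof -
    have "inner_conj v (inner_conj (u powi j) x) = inner_conj (u powi j) (inner_conj v x)"
      using powi_commute[OF assms(1), of j] by (simp add: inner_conj_inner_conj)
    also have "inner_conj v x = x"
      using assms by (intro inner_conj_eqI)
    finally show ?thesis
      using inner_conj_powi_add[OF assms(2), of 1 j x]
      by (simp add: inner_conj_inner_conj[symmetric] add.commute)
  qed
  show ?thesis
  proof (induction i rule: int_induct[where k = 0])
    case base
    show ?case by simp
  next
    case (step1 i)
    then show ?case
      using inner_conj_powi_add[OF uv, of 1 i x] step[of i] by (simp add: add.commute)
  next
    case (step2 i)
    have "inner_conj (u powi (i - 1)) x
        = inner_conj ((u * v) powi - 1) (inner_conj (u * v) (inner_conj (u powi (i - 1)) x))"
      using inner_conj_powi_add[OF uv, of "- 1" 1] by simp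
    also have "\<dots> = inner_conj ((u * v) powi - 1) (inner_conj ((u * v) powi i) x)"
      using step[of "i - 1"] step2 by simp
    also have "\<dots> = inner_conj ((u * v) powi (i - 1)) x"
      using inner_conj_powi_add[OF uv, of "- 1" i x] by simp
    finally show ?case ..
  qed
qed

section \<open>Automorphisms\<close>

text \<open>
  The fractions of the largest ring of the tower are all of the ambient type, so
  \<open>linear_automorphism R UNIV\<close> is the relevant case from now on.
\<close>

lemma linear_automorphism_UNIV:
  assumes "linear_automorphism R UNIV g"
  shows linear_automorphism_bij: "bij g"
    and linear_automorphism_one: "g 1 = 1"
    and linear_automorphism_mult: "g (x * y) = g x * g y"
    and linear_automorphism_fixes: "r \<in> R \<Longrightarrow> g r = r"
proof -
  show "bij g" "g 1 = 1" "g (x * y) = g x * g y"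
    using assms by (auto simp: linear_automorphism_def)
  show "g r = r" if "r \<in> R"
    using assms that by (metis UNIV_I linear_automorphism_def mult.right_neutral)
qed

lemma linear_automorphism_inverse:
  assumes "linear_automorphism R UNIV g"
  shows "g (inverse x) = inverse (g x)"
proof (cases "x = 0")
  case True
  have "g 0 = g 0 + g 0"
    using assms by (metis UNIV_I add_0 linear_automorphism_def)
  then show ?thesis using True by simp
next
  case False
  then have "g (inverse x) * g x = 1"
    using linear_automorphism_mult[OF assms, symmetric] linear_automorphism_one[OF assms] by simp
  then show ?thesis by (metis inverse_inverse_eq inverse_unique)
qed

lemma linear_automorphism_inner_conj:
  assumes "linear_automorphism R UNIV g"
  shows "g (inner_conj u x) = inner_conj (g u) (g x)"
  using assms
  by (simp add: inner_conj_def linear_automorphism_mult[OF assms]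
      linear_automorphism_inverse[OF assms])

lemma linear_automorphism_powi_fixes:
  assumes "linear_automorphism R UNIV g" "g u = u"
  shows "g (u powi i) = u powi i"
proof -
  have pow: "g (v ^ k) = v ^ k" if "g v = v" for v k
    by (induction k)
      (simp_all add: that linear_automorphism_mult[OF assms(1)] linear_automorphism_one[OF assms(1)])
  show ?thesis
    using pow assms(2) linear_automorphism_inverse[OF assms(1), of u]
    by (simp add: power_int_def)
qed

lemma inner_conj_linear_automorphism:
  fixes u :: "'d::division_ring"
  assumes "u \<noteq> 0" "\<And>r. r \<in> R \<Longrightarrow> u * r = r * u"
  shows "linear_automorphism R UNIV (inner_conj u)"
proof -
  have "inner_conj (inverse u) (inner_conj u x) = x" "inner_conj u (inner_conj (inverse u) x) = x" for x
    using assms(1) by (simp_all add: inner_conj_inner_conj)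
  then have "bij (inner_conj u)"
    by (intro o_bij[of "inner_conj (inverse u)"]) (auto simp: fun_eq_iff)
  moreover have "inner_conj u (r * x) = r * inner_conj u x" if "r \<in> R" for r x
    using inner_conj_mult[OF assms(1), of r x] inner_conj_eqI[OF assms(2)[OF that] assms(1)]
    by simp
  moreover have "inner_conj u 1 = 1"
    using assms(1) by (simp add: inner_conj_def)
  ultimately show ?thesis
    by (simp add: linear_automorphism_def inner_conj_add inner_conj_mult[OF assms(1)])
qed

lemma aut_pow_eqI_nonpos:
  assumes "bij g" "z \<le> 0" "(g ^^ nat (- z)) y = x"
  shows "aut_pow g z x = y"
proof -
  have "(inv g ^^ k) ((g ^^ k) y) = y" for k
    using inv_fn[OF assms(1)] bij_is_inj[OF bij_fn[OF assms(1)]] by (metis inv_f_f)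
  then show ?thesis
    using assms by (cases "z = 0") (auto simp: aut_pow_def)
qed

text \<open>
  Since \<open>g\<close> fixes \<open>u\<close>, it commutes with conjugation by \<open>u\<close>; so once \<open>g\<^sup>a\<close> agrees with this
  conjugation at \<open>x\<close>, all powers of the two agree there.
\<close>

lemma aut_pow_eq_inner_conj:
  assumes g: "linear_automorphism R UNIV g" and "g u = u" "u \<noteq> 0"
    and base: "(g ^^ a) x = inner_conj u x"
  shows "aut_pow g (l * int a) x = inner_conj (u powi l) x"
proof -
  have equivariant: "(g ^^ k) (inner_conj (u powi i) y) = inner_conj (u powi i) ((g ^^ k) y)" for k i y
    by (induction k)
      (simp_all add: linear_automorphism_inner_conj[OF g]
        linear_automorphism_powi_fixes[OF g \<open>g u = u\<close>])
  have pos: "(g ^^ (c * a)) x = inner_conj (u powi int c) x" for c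
  proof (induction c)
    case 0
    show ?case by simp
  next
    case (Suc c)
    have "(g ^^ (Suc c * a)) x = (g ^^ a) ((g ^^ (c * a)) x)"
      by (simp add: funpow_add)
    also have "\<dots> = inner_conj (u powi int c) (inner_conj (u powi 1) x)"
      by (simp only: Suc equivariant base power_int_1_right)
    also have "\<dots> = inner_conj (u powi (int c + 1)) x"
      by (rule inner_conj_powi_add[OF \<open>u \<noteq> 0\<close>])
    finally show ?case by (simp only: of_nat_Suc add.commute)
  qed
  show ?thesis
  proof (cases "0 \<le> l")
    case True
    then obtain c where "l = int c" by (metis nonneg_int_cases)
    then show ?thesis
      using pos[of c] by (simp add: aut_pow_def flip: of_nat_mult)
  next
    case False
    then obtain c where c: "l = - int c" by (metis nonpos_int_cases linear)
    have "(g ^^ (c * a)) (inner_conj (u powi l) x) = x"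
      using inner_conj_powi_add[OF \<open>u \<noteq> 0\<close>, of l "int c" x] by (simp only: equivariant pos) (simp add: c)
    then show ?thesis
      by (intro aut_pow_eqI_nonpos linear_automorphism_bij[OF g]) (auto simp: c nat_mult_distrib)
  qed
qed

section \<open>Mutation orbits\<close>

text \<open>
  The two ranges are the results of an even and of an odd number of mutations in one direction.
  Their elements are \<open>\<xi>\<^sup>i x \<xi>\<^sup>-\<^sup>i\<close> and \<open>\<xi>\<^sup>i\<^sup>+\<^sup>1 x\<inverse> \<xi>\<^sup>-\<^sup>i\<close>.
\<close>

definition exchange_orbit :: "'d::division_ring \<Rightarrow> 'd \<Rightarrow> 'd set" where
  "exchange_orbit \<xi> x =
     range (\<lambda>i::int. inner_conj (\<xi> powi i) x) \<union>
     range (\<lambda>i::int. \<xi> * inner_conj (\<xi> powi i) (inverse x))"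

lemma right_exchange_even:
  "\<xi> * inverse (inner_conj (\<xi> powi i) x) = \<xi> * inner_conj (\<xi> powi i) (inverse x)"
  by (simp add: inverse_inner_conj)

lemma right_exchange_odd:
  assumes "\<xi> \<noteq> 0"
  shows "\<xi> * inverse (\<xi> * inner_conj (\<xi> powi i) (inverse x)) = inner_conj (\<xi> powi (i + 1)) x"
proof -
  have "\<xi> * inverse (\<xi> * inner_conj (\<xi> powi i) (inverse x)) = inner_conj \<xi> (inner_conj (\<xi> powi i) x)"
    by (simp add: inverse_mult_distrib_division_ring inverse_inner_conj)
      (simp add: inner_conj_def mult.assoc)
  then show ?thesis
    using inner_conj_powi_add[OF assms, of 1 i x] by (simp add: add.commute)
qed

lemma left_exchange_even:
  assumes "\<xi> \<noteq> 0"
  shows "inverse (inner_conj (\<xi> powi i) x) * \<xi> = \<xi> * inner_conj (\<xi> powi (i - 1)) (inverse x)"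
proof -
  have "inner_conj (\<xi> powi i) (inverse x) = inner_conj \<xi> (inner_conj (\<xi> powi (i - 1)) (inverse x))"
    using inner_conj_powi_add[OF assms, of 1 "i - 1" "inverse x"] by simp
  then have "inner_conj (\<xi> powi i) (inverse x) * \<xi> = \<xi> * inner_conj (\<xi> powi (i - 1)) (inverse x)"
    using assms by (simp add: inner_conj_def[of \<xi>] mult.assoc)
  then show ?thesis by (simp add: inverse_inner_conj)
qed

lemma left_exchange_odd:
  assumes "\<xi> \<noteq> 0"
  shows "inverse (\<xi> * inner_conj (\<xi> powi i) (inverse x)) * \<xi> = inner_conj (\<xi> powi i) x"
  using assms by (simp add: inverse_mult_distrib_division_ring inverse_inner_conj mult.assoc)

lemma exchange_orbit_closed:
  assumes "\<xi> \<noteq> 0" "y \<in> exchange_orbit \<xi> x"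
  shows "\<xi> * inverse y \<in> exchange_orbit \<xi> x" "inverse y * \<xi> \<in> exchange_orbit \<xi> x"
  using assms(2) unfolding exchange_orbit_def
  by (auto simp: right_exchange_even right_exchange_odd[OF assms(1)] left_exchange_even[OF assms(1)]
      left_exchange_odd[OF assms(1)])

lemma exchange_orbit_least:
  assumes "\<xi> \<noteq> 0" "x \<in> A"
    and right: "\<And>y. y \<in> A \<Longrightarrow> \<xi> * inverse y \<in> A"
    and left: "\<And>y. y \<in> A \<Longrightarrow> inverse y * \<xi> \<in> A"
  shows "exchange_orbit \<xi> x \<subseteq> A"
proof -
  have odd: "\<xi> * inner_conj (\<xi> powi i) (inverse x) \<in> A" if "inner_conj (\<xi> powi i) x \<in> A" for i
    using right[OF that] by (simp add: right_exchange_even)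
  have even: "inner_conj (\<xi> powi i) x \<in> A" for i
  proof (induction i rule: int_induct[where k = 0])
    case base
    show ?case using assms(2) by simp
  next
    case (step1 i)
    show ?case
      using right[OF odd[OF step1(2)]] by (simp only: right_exchange_odd[OF assms(1)])
  next
    case (step2 i)
    show ?case
      using left[OF left[OF step2(2)]]
      by (simp only: left_exchange_even[OF assms(1)] left_exchange_odd[OF assms(1)])
  qed
  show ?thesis using even odd by (auto simp: exchange_orbit_def)
qed

text \<open>Applying \<open>g\<close> adds \<open>l\<close> to the conjugation exponents in both ranges.\<close>

lemma exchange_orbit_invariant:
  assumes g: "linear_automorphism R UNIV g" and "g \<xi> = \<xi>" "\<xi> \<noteq> 0"
    and gx: "g x = inner_conj (\<xi> powi l) x"
  shows "g ` exchange_orbit \<xi> x = exchange_orbit \<xi> x"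
proof -
  have even: "g (inner_conj (\<xi> powi i) x) = inner_conj (\<xi> powi (i + l)) x" for i
    using inner_conj_powi_add[OF \<open>\<xi> \<noteq> 0\<close>, of i l x]
    by (simp add: linear_automorphism_inner_conj[OF g] gx
        linear_automorphism_powi_fixes[OF g \<open>g \<xi> = \<xi>\<close>])
  have odd: "g (\<xi> * inner_conj (\<xi> powi i) (inverse x)) = \<xi> * inner_conj (\<xi> powi (i + l)) (inverse x)" for i
    using inner_conj_powi_add[OF \<open>\<xi> \<noteq> 0\<close>, of i l "inverse x"]
    by (simp add: linear_automorphism_inner_conj[OF g] gx linear_automorphism_mult[OF g]
        linear_automorphism_inverse[OF g] inverse_inner_conj \<open>g \<xi> = \<xi>\<close>
        linear_automorphism_powi_fixes[OF g \<open>g \<xi> = \<xi>\<close>])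
  have shift: "range (\<lambda>i. h (i + l)) = range h" for h :: "int \<Rightarrow> 'a"
    using surj_plus_right[of l] by (metis image_image)
  show ?thesis
    by (simp add: exchange_orbit_def image_Un image_image even odd
        shift[of "\<lambda>i. inner_conj (\<xi> powi i) x"]
        shift[of "\<lambda>i. \<xi> * inner_conj (\<xi> powi i) (inverse x)"])
qed

lemma exchange_elem_reverse_quiver: "exchange_elem (reverse_quiver Q) k = exchange_elem Q k"
  by (simp add: exchange_elem_def reverse_quiver_def add.commute)

lemma mutation_reachable_exchange_elem:
  fixes emb :: "'k::field_char_0 group_ring \<Rightarrow> 'd::division_ring"
  assumes "mutation_reachable n emb p q"
  shows "exchange_elem (quivers q k) k = (exchange_elem (quivers p k) k :: 'k group_ring)"
  using assms
  by induction (auto simp: right_mutation_def left_mutation_def exchange_elem_reverse_quiver)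

text \<open>
  A mutation in direction \<open>k\<close> changes only the \<open>k\<close>-th cluster variable, and \<open>\<xi>\<^sub>k\<close> stays the same;
  so what can be reached in position \<open>k\<close> is the closure of \<open>x\<^sub>k\<close> under the two exchanges.
\<close>

lemma cluster_set_eq_orbits:
  fixes emb :: "'k::field_char_0 group_ring \<Rightarrow> 'd::division_ring"
  assumes nz: "\<And>k. k \<in> {1..n} \<Longrightarrow> emb (exchange_elem (quivers p k) k) \<noteq> 0"
  shows "cluster_set n emb p
       = (\<Union>k\<in>{1..n}. exchange_orbit (emb (exchange_elem (quivers p k) k)) (cluster p k))"
proof -
  define \<xi> where "\<xi> k = emb (exchange_elem (quivers p k) k)" for k
  have xi: "emb (exchange_elem (quivers q k) k) = \<xi> k" if "mutation_reachable n emb p q" for q k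
    using mutation_reachable_exchange_elem[OF that, of k] by (simp add: \<xi>_def)
  have "cluster q i \<in> exchange_orbit (\<xi> i) (cluster p i)"
    if "mutation_reachable n emb p q" "i \<in> {1..n}" for q i
    using that
  proof (induction)
    case start
    have "cluster p i = inner_conj (\<xi> i powi 0) (cluster p i)" by simp
    then show ?case unfolding exchange_orbit_def by blast
  next
    case (right q k)
    then show ?case
      using exchange_orbit_closed(1)[of "\<xi> i"] nz[of i] xi[OF right.hyps(1)]
      by (auto simp: right_mutation_def \<xi>_def)
  next
    case (left q k)
    then show ?case
      using exchange_orbit_closed(2)[of "\<xi> i"] nz[of i] xi[OF left.hyps(1)]
      by (auto simp: left_mutation_def \<xi>_def)
  qed
  moreover have "exchange_orbit (\<xi> k) (cluster p k) \<subseteq> {cluster q k | q. mutation_reachable n emb p q}"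
    if k: "k \<in> {1..n}" for k
  proof (rule exchange_orbit_least)
    show "\<xi> k \<noteq> 0" using nz[OF k] by (simp add: \<xi>_def)
    show "cluster p k \<in> {cluster q k | q. mutation_reachable n emb p q}"
      using mutation_reachable.start by blast
  next
    fix y assume "y \<in> {cluster q k | q. mutation_reachable n emb p q}"
    then obtain q where q: "mutation_reachable n emb p q" "y = cluster q k" by blast
    have "cluster (right_mutation emb k q) k = \<xi> k * inverse y"
      "cluster (left_mutation emb k q) k = inverse y * \<xi> k"
      using q xi by (simp_all add: right_mutation_def left_mutation_def)
    then show "\<xi> k * inverse y \<in> {cluster q k | q. mutation_reachable n emb p q}"
      and "inverse y * \<xi> k \<in> {cluster q k | q. mutation_reachable n emb p q}"
      using mutation_reachable.right[OF q(1) k] mutation_reachable.left[OF q(1) k]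
      by (metis (mono_tags, lifting) mem_Collect_eq)+
  qed
  ultimately show ?thesis
    unfolding cluster_set_def \<xi>_def[symmetric] by blast
qed

section \<open>The ground ring\<close>

lemma ground_ring_one: "1 \<in> ground_ring m i"
  by (simp add: ground_ring_def frozen_group_def)

lemma ground_ring_add: "x \<in> ground_ring m i \<Longrightarrow> y \<in> ground_ring m i \<Longrightarrow> x + y \<in> ground_ring m i"
  using keys_add[of x y] by (auto simp: ground_ring_def)

lemma frozen_group_add: "p \<in> frozen_group m i \<Longrightarrow> q \<in> frozen_group m i \<Longrightarrow> p + q \<in> frozen_group m i"
  using keys_add[of p q] unfolding frozen_group_def by blast

lemma ground_ring_mult:
  assumes "x \<in> ground_ring m i" "y \<in> ground_ring m i"
  shows "x * y \<in> ground_ring m i"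
  using assms keys_mult[of x y] frozen_group_add unfolding ground_ring_def by blast

lemma ground_ring_prod: "(\<And>j. j \<in> A \<Longrightarrow> f j \<in> ground_ring m i) \<Longrightarrow> prod f A \<in> ground_ring m i"
  by (induction A rule: infinite_finite_induct) (auto intro: ground_ring_one ground_ring_mult)

lemma frozen_var_in_ground_ring:
  "j \<in> {1..i} \<Longrightarrow> r \<in> {1..m j} \<Longrightarrow> frozen_var j r \<in> ground_ring m i"
  by (auto simp: frozen_var_def ground_ring_def frozen_group_def)

lemma ground_ring_mono: "i \<le> i' \<Longrightarrow> ground_ring m i \<subseteq> ground_ring m i'"
  unfolding ground_ring_def frozen_group_def by fastforce

text \<open>
  Both summands are monomials with coefficient \<open>1\<close>, so the coefficient of the exchange element at
  the first of them is \<open>1\<close> or \<open>2\<close>.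
\<close>

lemma exchange_elem_nonzero: "exchange_elem Q k \<noteq> (0 :: 'k::field_char_0 group_ring)"
proof -
  define mono where "mono = (\<lambda>z :: 'k group_ring. \<exists>\<alpha>. z = Poly_Mapping.single \<alpha> 1)"
  have one: "mono 1" unfolding mono_def by (metis single_one)
  have mult: "mono (x * y)" if "mono x" "mono y" for x y
    using that unfolding mono_def by (auto simp: mult_single)
  have "mono (frozen_var k j)" for j
    by (auto simp: frozen_var_def mono_def)
  then have "mono (frozen_var k j ^ v)" for j v
    by (induction v) (auto intro: one mult)
  then have "mono (\<Prod>j\<in>A. frozen_var k j ^ v j)" for A v
    by (induction A rule: infinite_finite_induct) (auto intro: one mult)
  then obtain \<alpha> \<beta> where
    "exchange_elem Q k = Poly_Mapping.single \<alpha> (1::'k) + Poly_Mapping.single \<beta> 1"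
    unfolding exchange_elem_def mono_def by metis
  then have "Poly_Mapping.lookup (exchange_elem Q k :: 'k group_ring) \<alpha> \<noteq> 0"
    by (simp add: lookup_add lookup_single when_def)
  then show ?thesis by auto
qed

text \<open>
  There is no loop at the center \<open>0\<close>, so the products in the exchange element only involve
  variables \<open>f\<^sub>k\<^sub>j\<close> that belong to \<open>F\<^sub>k\<close>.
\<close>

lemma star_quiver_neighbours:
  fixes Q :: "nat quiver"
  assumes "star_quiver Q 0" "verts Q = {0..M}"
  shows "{j. (j, 0) \<in> arrows Q} \<subseteq> {1..M}" "{j. (0, j) \<in> arrows Q} \<subseteq> {1..M}"
proof -
  have Q: "arrows Q \<subseteq> {0..M} \<times> {0..M}" "(0, 0) \<notin> arrows Q"
    using assms by (auto simp: star_quiver_def valued_quiver_def)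
  have "j \<in> {1..M}" if j: "(j, 0) \<in> arrows Q \<or> (0, j) \<in> arrows Q" for j
  proof -
    have "j \<noteq> 0" using j Q(2) by (cases "j = 0") simp_all
    moreover have "j \<in> {0..M}" using j subsetD[OF Q(1)] by blast
    ultimately show ?thesis by simp
  qed
  then show "{j. (j, 0) \<in> arrows Q} \<subseteq> {1..M}" "{j. (0, j) \<in> arrows Q} \<subseteq> {1..M}"
    by blast+
qed

lemma exchange_elem_in_ground_ring:
  assumes "star_quiver Q 0" "verts Q = {0..m k}" "k \<in> {1..n}"
  shows "exchange_elem Q k \<in> ground_ring m n"
proof -
  have "frozen_var k j ^ v \<in> ground_ring m n" if "j \<in> {1..m k}" for j v
    by (induction v)
      (auto intro: ground_ring_one ground_ring_mult frozen_var_in_ground_ring assms(3) that)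
  then show ?thesis
    unfolding exchange_elem_def using star_quiver_neighbours[OF assms(1,2)]
    by (intro ground_ring_add ground_ring_prod) blast+
qed

section \<open>Commutation between frozen and cluster variables\<close>

context ore_tower
begin

lemma emb_zero: "emb 0 = 0"
proof -
  have "(0 :: 'k group_ring) \<in> ground_ring m n" by (simp add: ground_ring_def)
  then have "emb 0 = emb 0 + emb 0" using emb_add by fastforce
  then show ?thesis by simp
qed

lemma emb_nonzero: "z \<in> ground_ring m n \<Longrightarrow> z \<noteq> 0 \<Longrightarrow> emb z \<noteq> 0"
  using emb_inj emb_zero by (metis inj_on_eq_iff ground_ring_def keys_zero empty_subsetI mem_Collect_eq)

lemma emb_commute:
  "y \<in> ground_ring m n \<Longrightarrow> z \<in> ground_ring m n \<Longrightarrow> emb y * emb z = emb z * emb y"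
  by (metis emb_mult mult.commute)

lemma emb_prod_nonzero:
  assumes "\<And>j. j \<in> A \<Longrightarrow> z j \<in> ground_ring m n" "\<And>j. j \<in> A \<Longrightarrow> z j \<noteq> 0"
  shows "emb (prod z A) \<noteq> 0"
  using assms
  by (induction A rule: infinite_finite_induct)
    (simp_all add: emb_one emb_mult ground_ring_prod emb_nonzero)

text \<open>
  An element \<open>z\<close> of degree \<open>c\<close> moves past \<open>x\<close> at the cost of \<open>g\<^sup>c\<close>. With \<open>g\<close> the given automorphism
  \<open>\<phi>\<close> this describes how \<open>F\<^sub>k\<close> moves past \<open>x\<^sub>k\<close>; with \<open>g\<close> the identity it is plain commutation, which
  is the case of \<open>F\<^sub>j\<close> and \<open>x\<^sub>i\<close> for \<open>i \<noteq> j\<close>. Membership in the ground ring is included because \<open>emb\<close>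
  is only multiplicative there.
\<close>

definition intertwines :: "('d \<Rightarrow> 'd) \<Rightarrow> 'd \<Rightarrow> nat \<Rightarrow> 'k group_ring \<Rightarrow> bool" where
  "intertwines g x c z \<longleftrightarrow> z \<in> ground_ring m n \<and> emb z * x = (g ^^ c) x * emb z"

lemma intertwines_one: "intertwines g x 0 1"
  by (simp add: intertwines_def ground_ring_one emb_one)

lemma intertwines_add: "intertwines g x c y \<Longrightarrow> intertwines g x c z \<Longrightarrow> intertwines g x c (y + z)"
  by (simp add: intertwines_def ground_ring_add emb_add distrib_left distrib_right)

lemma intertwines_mult:
  assumes g: "linear_automorphism (emb ` ground_ring m n) UNIV g"
    and "intertwines g x c y" "intertwines g x d z"
  shows "intertwines g x (c + d) (y * z)"
proof -
  have y: "y \<in> ground_ring m n" "emb y * x = (g ^^ c) x * emb y"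
    and z: "z \<in> ground_ring m n" "emb z * x = (g ^^ d) x * emb z"
    using assms by (auto simp: intertwines_def)
  have power: "(g ^^ k) (u * v) = (g ^^ k) u * (g ^^ k) v" for k u v
    by (induction k) (simp_all add: linear_automorphism_mult[OF g])
  have invariant: "(g ^^ k) (emb y) = emb y" for k
    using linear_automorphism_fixes[OF g] y(1) by (induction k) auto
  have "emb (y * z) * x = emb y * (g ^^ d) x * emb z"
    using y z by (simp add: emb_mult mult.assoc)
  also have "emb y * (g ^^ d) x = (g ^^ d) (emb y * x)"
    by (simp add: power invariant)
  also have "\<dots> = (g ^^ (c + d)) x * emb y"
    by (simp add: y(2) power invariant funpow_add add.commute[of c d])
  finally show ?thesis
    using y z by (simp add: intertwines_def emb_mult ground_ring_mult mult.assoc)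
qed

lemma intertwines_monomial:
  assumes g: "linear_automorphism (emb ` ground_ring m n) UNIV g"
    and "\<And>j. j \<in> A \<Longrightarrow> intertwines g x 1 (f j)"
  shows "intertwines g x (\<Sum>j\<in>A. v j) (\<Prod>j\<in>A. f j ^ v j)"
proof -
  have "intertwines g x k (f j ^ k)" if "j \<in> A" for j k
  proof (induction k)
    case (Suc k)
    then show ?case using intertwines_mult[OF g assms(2)[OF that] Suc] by simp
  qed (simp add: intertwines_one)
  then show ?thesis
    by (induction A rule: infinite_finite_induct) (auto intro: intertwines_one intertwines_mult[OF g])
qed

text \<open>
  By balancedness both summands of the exchange element are products of \<open>a\<close> frozen variables,
  counted with multiplicity, so both intertwine with the same power of \<open>g\<close>.
\<close>

lemma exchange_elem_intertwines:
  assumes g: "linear_automorphism (emb ` ground_ring m n) UNIV g"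
    and k: "k \<in> {1..n}" and Q: "star_quiver Q 0" "verts Q = {0..m k}" "balanced_star Q 0 a"
    and x: "\<And>r. r \<in> {1..m k} \<Longrightarrow> emb (frozen_var k r) * x = g x * emb (frozen_var k r)"
  shows "intertwines g x a (exchange_elem Q k)"
proof -
  have one: "intertwines g x 1 (frozen_var k r)" if "r \<in> {1..m k}" for r
    using x[OF that] k that by (simp add: intertwines_def frozen_var_in_ground_ring)
  have "intertwines g x (\<Sum>j | (j, 0) \<in> arrows Q. val Q j 0)
          (\<Prod>j | (j, 0) \<in> arrows Q. frozen_var k j ^ val Q j 0)"
    "intertwines g x (\<Sum>j | (0, j) \<in> arrows Q. val Q 0 j)
          (\<Prod>j | (0, j) \<in> arrows Q. frozen_var k j ^ val Q 0 j)"
    using star_quiver_neighbours[OF Q(1,2)] by (auto intro!: intertwines_monomial[OF g] one)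
  then show ?thesis
    using Q(3) unfolding exchange_elem_def balanced_star_def by (auto intro: intertwines_add)
qed

lemma D_subset_fractions: "i \<in> {1..n} \<Longrightarrow> D i \<subseteq> right_fractions (D i)"
proof
  fix y assume "i \<in> {1..n}" "y \<in> D i"
  then have "1 \<in> D i" "y = y * inverse 1"
    using D_ore[of i] by (auto simp: is_ore_domain_def is_subring_def)
  then show "y \<in> right_fractions (D i)"
    using \<open>y \<in> D i\<close> unfolding right_fractions_def by (metis (mono_tags, lifting) mem_Collect_eq zero_neq_one)
qed

text \<open>
  For \<open>f\<close> a frozen variable of a level after \<open>i\<close>: the ring \<open>D\<^sub>i\<close> is spanned over the commutative
  ring \<open>R\<^sub>i\<close> by the monomials in \<open>t\<^sub>1, \<dots>, t\<^sub>i\<close>, and both \<open>R\<^sub>i\<close> and these monomials commute with \<open>f\<close>.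
  Hence so do the elements of \<open>D\<^sub>i\<close> and their fractions.
\<close>

lemma later_frozen_var_central:
  assumes i: "i \<in> {1..n}" and j: "j \<in> {1..n}" "i < j" and r: "r \<in> {1..m j}"
    and y: "y \<in> right_fractions (D i)"
  shows "emb (frozen_var j r) * y = y * emb (frozen_var j r)"
proof -
  define f where "f = emb (frozen_var j r)"
  have fin: "frozen_var j r \<in> ground_ring m n"
    using frozen_var_in_ground_ring j(1) r by blast
  have coeff: "f * c = c * f" if c: "c \<in> emb ` ground_ring m i" for c
  proof -
    have "ground_ring m i \<subseteq> (ground_ring m n :: 'k group_ring set)"
      using i by (intro ground_ring_mono) simp
    then show ?thesis
      using c emb_commute[OF fin] unfolding f_def by blast
  qed
  have monomial: "f * t_monomial t i \<alpha> = t_monomial t i \<alpha> * f" for \<alpha>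
  proof -
    have factor: "f * t s powi \<alpha> s = t s powi \<alpha> s * f" if "s \<in> set [1..<Suc i]" for s
    proof -
      have "t s * f = f * t s"
        unfolding f_def using that i j r by (intro t_frozen_commute) auto
      then show ?thesis by (metis powi_commute)
    qed
    have "f * prod_list (map (\<lambda>s. t s powi \<alpha> s) ss) = prod_list (map (\<lambda>s. t s powi \<alpha> s) ss) * f"
      if "set ss \<subseteq> set [1..<Suc i]" for ss
      using that
    proof (induction ss)
      case (Cons s ss)
      let ?u = "t s powi \<alpha> s" and ?v = "prod_list (map (\<lambda>s. t s powi \<alpha> s) ss)"
      have mem: "s \<in> set [1..<Suc i]" "set ss \<subseteq> set [1..<Suc i]"
        using Cons.prems by (simp_all only: list.set insert_subset)
      have "f * (?u * ?v) = (f * ?u) * ?v" by (rule mult.assoc[symmetric])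
      also have "\<dots> = ?u * (f * ?v)" by (simp only: factor[OF mem(1)] mult.assoc)
      also have "\<dots> = (?u * ?v) * f" by (simp only: Cons.IH[OF mem(2)] mult.assoc)
      finally show ?case by (simp only: list.map prod_list.Cons)
    qed simp
    then show ?thesis unfolding t_monomial_def by blast
  qed
  have D: "f * d = d * f" if d: "d \<in> D i" for d
  proof -
    have "\<exists>S c. finite S \<and> S \<subseteq> {1..i} \<rightarrow>\<^sub>E (UNIV :: int set) \<and> c ` S \<subseteq> emb ` ground_ring m i
        \<and> d = (\<Sum>s\<in>S. c s * t_monomial t i s)"
      using t_basis[OF i] unfolding is_left_basis_def by (elim conjE) (drule bspec[OF _ d])
    then obtain S c where S: "c ` S \<subseteq> emb ` ground_ring m i" "d = (\<Sum>s\<in>S. c s * t_monomial t i s)"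
      by (elim exE conjE)
    have "f * (c s * t_monomial t i s) = c s * t_monomial t i s * f" if "s \<in> S" for s
    proof -
      have "f * c s = c s * f" using S(1) that by (intro coeff) blast
      then have "f * (c s * t_monomial t i s) = c s * (f * t_monomial t i s)"
        by (simp add: mult.assoc[symmetric])
      then show ?thesis by (simp add: monomial mult.assoc)
    qed
    then show ?thesis by (simp add: S(2) sum_distrib_left sum_distrib_right cong: sum.cong)
  qed
  obtain b d where bd: "b \<in> D i" "d \<in> D i" "y = b * inverse d"
    using y unfolding right_fractions_def by blast
  have "f * inverse d = inverse d * f"
    using mult_commute_imp_mult_inverse_commute[of d f] D[OF bd(2)] by simp
  then have "f * y = y * f"
    using D[OF bd(1)] by (metis bd(3) mult.assoc)
  then show ?thesis by (simp add: f_def)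
qed

text \<open>
  For \<open>j > i\<close> the frozen variable commutes with everything at level \<open>i\<close>. For \<open>j < i\<close> it commutes
  with \<open>t\<^sub>i\<close>, and the automorphism carrying \<open>t\<^sub>i\<close> to \<open>x\<^sub>i\<close> fixes it.
\<close>

lemma cluster_frozen_commute:
  assumes p: "is_preseed n m emb D t p"
    and ij: "i \<in> {1..n}" "j \<in> {1..n}" "i \<noteq> j" and r: "r \<in> {1..m j}"
  shows "emb (frozen_var j r) * cluster p i = cluster p i * emb (frozen_var j r)"
proof -
  obtain \<sigma> where \<sigma>: "linear_automorphism (emb ` ground_ring m i) (right_fractions (D i)) \<sigma>"
    "\<forall>j\<in>{1..i}. \<forall>r\<in>{1..m j}. \<sigma> (emb (frozen_var j r)) = emb (frozen_var j r)"
    "cluster p i = \<sigma> (t i)"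
    using p ij(1) unfolding is_preseed_def by blast
  have ti: "t i \<in> right_fractions (D i)"
    using t_unit[OF ij(1)] D_subset_fractions[OF ij(1)] by blast
  show ?thesis
  proof (cases "i < j")
    case True
    have "\<sigma> (t i) \<in> right_fractions (D i)"
      using \<sigma>(1) ti by (auto simp: linear_automorphism_def bij_betw_def)
    then show ?thesis
      using later_frozen_var_central[OF ij(1,2) True r] \<sigma>(3) by simp
  next
    case False
    then have j: "j \<in> {1..i}" using ij by auto
    define f where "f = emb (frozen_var j r)"
    have "frozen_var j r \<in> ground_ring m i"
      using frozen_var_in_ground_ring j r by blast
    then have f: "f \<in> right_fractions (D i)"
      using ground_subset[OF ij(1)] D_subset_fractions[OF ij(1)] unfolding f_def by blast
    have mult: "\<sigma> (u * v) = \<sigma> u * \<sigma> v"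
      if "u \<in> right_fractions (D i)" "v \<in> right_fractions (D i)" for u v
      using \<sigma>(1) that by (simp add: linear_automorphism_def)
    have "\<sigma> f = f" using \<sigma>(2) j r by (simp add: f_def)
    moreover have "t i * f = f * t i"
      unfolding f_def using ij r by (intro t_frozen_commute)
    ultimately have "f * \<sigma> (t i) = \<sigma> (t i) * f"
      using mult[OF ti f] mult[OF f ti] by simp
    then show ?thesis by (simp add: f_def \<sigma>(3))
  qed
qed

section \<open>Cluster variable preservers\<close>

text \<open>
  Balancedness gives \<open>\<xi>\<^sub>k x\<^sub>k = \<phi>\<^bsup>a\<^sub>k\<^esup>(x\<^sub>k) \<xi>\<^sub>k\<close>, that is, the claim for \<open>l = 1\<close>; the other exponents
  follow because \<open>\<phi>\<close> fixes \<open>\<xi>\<^sub>k\<close>.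
\<close>

lemma aut_pow_cluster_eq_inner_conj:
  assumes p: "is_preseed n m emb D t p" "balanced_preseed n p a"
    and \<phi>: "phi_commutative n m emb D p \<phi>" and k: "k \<in> {1..n}"
  shows "aut_pow \<phi> (l * int (a k)) (cluster p k)
       = inner_conj (emb (exchange_elem (quivers p k) k) powi l) (cluster p k)"
proof -
  have Q: "star_quiver (quivers p k) 0" "verts (quivers p k) = {0..m k}"
    "balanced_star (quivers p k) 0 (a k)"
    using p k by (auto simp: is_preseed_def balanced_preseed_def)
  have aut: "linear_automorphism (emb ` ground_ring m n) UNIV \<phi>"
    using \<phi> fractions_top by (simp add: phi_commutative_def)
  have "intertwines \<phi> (cluster p k) (a k) (exchange_elem (quivers p k) k)"
    using \<phi> k by (intro exchange_elem_intertwines[OF aut k Q]) (simp add: phi_commutative_def)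
  moreover have in_R: "exchange_elem (quivers p k) k \<in> ground_ring m n"
    by (rule exchange_elem_in_ground_ring[where m = m, OF Q(1,2) k])
  moreover note nz = emb_nonzero[OF in_R exchange_elem_nonzero]
  ultimately show ?thesis
    using linear_automorphism_fixes[OF aut]
    by (intro aut_pow_eq_inner_conj[OF aut]) (auto simp: intertwines_def intro: inner_conj_eqI[symmetric])
qed

text \<open>
  The witness is conjugation by the \<open>l\<close>-th power of \<open>u = \<Prod>\<^sub>k \<xi>\<^sub>k\<close>. It fixes \<open>R\<^sub>n\<close> since \<open>u\<close> lies in this
  commutative ring.
\<close>

lemma induced_automorphism_exists:
  assumes p: "is_preseed n m emb D t p" "balanced_preseed n p a"
    and \<phi>: "phi_commutative n m emb D p \<phi>"
  shows "\<exists>\<psi>. induced_automorphism n m emb D p \<phi> a l \<psi>"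
proof -
  define z where "z k = (exchange_elem (quivers p k) k :: 'k group_ring)" for k
  define u where "u = emb (\<Prod>k\<in>{1..n}. z k)"
  have Q: "star_quiver (quivers p k) 0" "verts (quivers p k) = {0..m k}"
    "balanced_star (quivers p k) 0 (a k)" if "k \<in> {1..n}" for k
    using p that by (auto simp: is_preseed_def balanced_preseed_def)
  have z: "z k \<in> ground_ring m n" "z k \<noteq> 0" if "k \<in> {1..n}" for k
    unfolding z_def
    by (rule exchange_elem_in_ground_ring[where k = k and m = m, OF Q(1,2)[OF that] that],
        rule exchange_elem_nonzero)
  have u: "u \<noteq> 0" unfolding u_def by (intro emb_prod_nonzero z)
  have "(\<Prod>k\<in>{1..n}. z k) \<in> ground_ring m n"
    by (intro ground_ring_prod z)
  then have central: "u * r = r * u" if "r \<in> emb ` ground_ring m n" for r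
    unfolding u_def using that emb_commute by blast
  have aut: "linear_automorphism (emb ` ground_ring m n) UNIV (inner_conj (u powi l))"
    using u central by (intro inner_conj_linear_automorphism powi_commute) auto
  have id: "linear_automorphism (emb ` ground_ring m n) UNIV (\<lambda>x. x)"
    by (simp add: linear_automorphism_def bij_betw_def)
  have commute: "emb (z j) * cluster p k = cluster p k * emb (z j)"
    if "k \<in> {1..n}" "j \<in> {1..n}" "j \<noteq> k" for j k
  proof -
    have "intertwines (\<lambda>x. x) (cluster p k) (a j) (z j)"
      unfolding z_def using that
      by (intro exchange_elem_intertwines[OF id _ Q] cluster_frozen_commute[OF p(1)]) auto
    moreover have "((\<lambda>x. x) ^^ c) y = y" for c and y :: 'd
      by (induction c) auto
    ultimately show ?thesis by (simp add: intertwines_def)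
  qed
  have "inner_conj (u powi l) (cluster p k) = aut_pow \<phi> (l * int (a k)) (cluster p k)"
    if k: "k \<in> {1..n}" for k
  proof -
    define v where "v = emb (\<Prod>j\<in>{1..n} - {k}. z j)"
    have rest: "(\<Prod>j\<in>{1..n} - {k}. z j) \<in> ground_ring m n"
      using z by (intro ground_ring_prod) auto
    have "(\<Prod>j\<in>{1..n}. z j) = z k * (\<Prod>j\<in>{1..n} - {k}. z j)"
      using k by (intro prod.remove) auto
    then have u_eq: "u = emb (z k) * v"
      unfolding u_def v_def using z[OF k] rest by (simp add: emb_mult)
    have "emb (\<Prod>j\<in>A. z j) * cluster p k = cluster p k * emb (\<Prod>j\<in>A. z j)"
      if "A \<subseteq> {1..n} - {k}" for A
      using that
    proof (induction A rule: infinite_finite_induct)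
      case (insert j A)
      have "z j \<in> ground_ring m n" "prod z A \<in> ground_ring m n"
        "emb (z j) * cluster p k = cluster p k * emb (z j)"
        using insert.prems z by (auto intro!: ground_ring_prod commute[OF k])
      then show ?case
        using insert by (simp add: emb_mult) (metis mult.assoc)
    qed (simp_all add: emb_one)
    then have "v * cluster p k = cluster p k * v" unfolding v_def by blast
    moreover have "emb (z k) * v = v * emb (z k)"
      unfolding v_def by (rule emb_commute[OF z(1)[OF k] rest])
    moreover have "emb (z k) \<noteq> 0" "v \<noteq> 0" using u by (auto simp: u_eq)
    ultimately have "inner_conj (u powi l) (cluster p k) = inner_conj (emb (z k) powi l) (cluster p k)"
      unfolding u_eq by (intro inner_conj_powi_mult_left)
    then show ?thesis
      using aut_pow_cluster_eq_inner_conj[OF p \<phi> k] by (simp add: z_def)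
  qed
  moreover have "inner_conj (u powi l) (emb r) = emb r" if "r \<in> ground_ring m n" for r
    using central u that by (intro inner_conj_powi_commute) auto
  ultimately have "induced_automorphism n m emb D p \<phi> a l (inner_conj (u powi l))"
    using aut fractions_top by (simp add: induced_automorphism_def)
  then show ?thesis by blast
qed

lemma induced_automorphism_preserves:
  assumes p: "is_preseed n m emb D t p" "balanced_preseed n p a"
    and \<phi>: "phi_commutative n m emb D p \<phi>"
    and \<psi>: "induced_automorphism n m emb D p \<phi> a l \<psi>"
  shows "cluster_variable_preserver n m emb D p \<psi>"
proof -
  have aut: "linear_automorphism (emb ` ground_ring m n) UNIV \<psi>"
    using \<psi> fractions_top by (simp add: induced_automorphism_def)
  have in_R: "exchange_elem (quivers p k) k \<in> ground_ring m n" if "k \<in> {1..n}" for k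
    using p(1) that by (intro exchange_elem_in_ground_ring) (auto simp: is_preseed_def)
  have nz: "emb (exchange_elem (quivers p k) k) \<noteq> 0" if "k \<in> {1..n}" for k
    using emb_nonzero[OF in_R[OF that] exchange_elem_nonzero] .
  have "\<psi> ` exchange_orbit (emb (exchange_elem (quivers p k) k)) (cluster p k)
      = exchange_orbit (emb (exchange_elem (quivers p k) k)) (cluster p k)" if k: "k \<in> {1..n}" for k
  proof (rule exchange_orbit_invariant[OF aut])
    show "\<psi> (emb (exchange_elem (quivers p k) k)) = emb (exchange_elem (quivers p k) k)"
      using linear_automorphism_fixes[OF aut] in_R[OF k] by blast
    show "emb (exchange_elem (quivers p k) k) \<noteq> 0" by (rule nz[OF k])
    show "\<psi> (cluster p k) = inner_conj (emb (exchange_elem (quivers p k) k) powi l) (cluster p k)"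
      using \<psi> k aut_pow_cluster_eq_inner_conj[OF p \<phi> k] by (simp add: induced_automorphism_def)
  qed
  then have "\<psi> ` cluster_set n emb p = cluster_set n emb p"
    by (subst (1 2) cluster_set_eq_orbits) (use nz in \<open>simp_all add: image_UN\<close>)
  then show ?thesis
    using aut fractions_top by (simp add: cluster_variable_preserver_def)
qed

end

theorem theorem3p17:
  fixes n :: nat
    and m :: "nat \<Rightarrow> nat"
    and emb :: "'k::field_char_0 group_ring \<Rightarrow> 'd::division_ring"
    and D :: "nat \<Rightarrow> 'd set"
    and t :: "nat \<Rightarrow> 'd"
    and p :: "'d preseed"
    and \<phi> :: "'d \<Rightarrow> 'd"
    and a :: "nat \<Rightarrow> nat"
  assumes "ore_tower n m emb D t"
    and "is_preseed n m emb D t p"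
    and "balanced_preseed n p a"
    and "phi_commutative n m emb D p \<phi>"
  shows "\<forall>l::int.
           (\<exists>\<psi>. induced_automorphism n m emb D p \<phi> a l \<psi>) \<and>
           (\<forall>\<psi>. induced_automorphism n m emb D p \<phi> a l \<psi> \<longrightarrow>
                 cluster_variable_preserver n m emb D p \<psi>)"
proof -
  interpret ore_tower n m emb D t by fact
  show ?thesis
    using induced_automorphism_exists[OF assms(2-4)] induced_automorphism_preserves[OF assms(2-4)]
    by blast
qed

end
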